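(* For all integers $k\ge 0$ and $n \ge k+3$ we have $\mathrm{av}_n^k(1324,1243)=p(k)$, where $p(k)$ is the number of integer partitions of $k$.
   Context: $\mathrm{av}_n^k(B)$ is the number of permutations in $S_n$ with exactly $k$ inversions (pairs $i<j$ with $\pi_i>\pi_j$) that avoid every pattern in $B$; a permutation avoids a pattern $q$ if it has no subsequence order-isomorphic to $q$. *)

theory Defs
  imports
    "HOL-Library.Multiset"
    "HOL-Library.Sublist"
    "HOL-Combinatorics.Multiset_Permutations"
begin

text \<open>
  Permutations of \<open>{1..n}\<close> and patterns are written in one-line notation, as lists of
  natural numbers, so that \<open>S\<^sub>n\<close> is \<^term>\<open>permutations_of_set {1..n::nat}\<close>. List positions are
  counted from 0; this affects neither inversions nor pattern containment.
\<close>

definition inversions :: "nat list \<Rightarrow> (nat \<times> nat) set" where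
  "inversions \<pi> = {(i, j). i < j \<and> j < length \<pi> \<and> \<pi> ! i > \<pi> ! j}"

definition order_isomorphic :: "nat list \<Rightarrow> nat list \<Rightarrow> bool" where
  "order_isomorphic s q \<longleftrightarrow> length s = length q \<and>
     (\<forall>i < length q. \<forall>j < length q. s ! i < s ! j \<longleftrightarrow> q ! i < q ! j)"

text \<open>
  \<^const>\<open>subseq\<close> deletes entries at arbitrary positions; subsequences need not be contiguous.
\<close>

definition avoids :: "nat list \<Rightarrow> nat list \<Rightarrow> bool" where
  "avoids \<pi> q \<longleftrightarrow> \<not> (\<exists>s. subseq s \<pi> \<and> order_isomorphic s q)"

definition av :: "nat \<Rightarrow> nat \<Rightarrow> nat list set \<Rightarrow> nat" where
  "av n k B = card {\<pi> \<in> permutations_of_set {1..n}.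
     card (inversions \<pi>) = k \<and> (\<forall>q\<in>B. avoids \<pi> q)}"

definition integer_partitions :: "nat \<Rightarrow> nat multiset set" where
  "integer_partitions k = {P. (\<forall>x \<in># P. 0 < x) \<and> \<Sum>\<^sub># P = k}"

definition num_partitions :: "nat \<Rightarrow> nat" where
  "num_partitions k = card (integer_partitions k)"

end

theory Submission
  imports Defs
begin

text \<open>
  If \<open>\<pi>\<close> avoids 1324 and 1243 but has an occurrence of 132 at positions \<open>a < b < c\<close>, then each of
  the \<open>n - 2\<close> positions other than \<open>a\<close> and \<open>b\<close> contributes an inversion of its own, so
  \<open>n \<le> k + 2\<close>. Hence for \<open>n \<ge> k + 3\<close> the permutations counted are exactly the 132-avoiding ones.
  Those are the permutations whose Lehmer code is weakly decreasing, and the sum of the code is the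
  number of inversions. The nonzero entries of the code therefore form a partition of \<open>k\<close>; for
  \<open>n > k\<close> every partition of \<open>k\<close>, padded with zeros, is the code of a permutation.
\<close>

section \<open>Pattern occurrences as increasing lists of positions\<close>

lemma subseq_nths_positions:
  assumes "sorted_wrt (<) is" "\<forall>i\<in>set is. i < length xs"
  shows "subseq (map ((!) xs) is) xs"
proof -
  \<comment> \<open>A strictly increasing list is determined by its set of entries, and a filter of
    a list is a subsequence of it.\<close>
  have "is = filter (\<lambda>i. i \<in> set is) [0..<length xs]"
    using assms by (intro sorted_distinct_set_unique)
      (auto simp: strict_sorted_iff sorted_wrt_filter)
  then have "subseq is [0..<length xs]"
    by (metis subseq_filter_left)
  then have "subseq (map ((!) xs) is) (map ((!) xs) [0..<length xs])"
    by (rule subseq_map)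
  then show ?thesis
    by (simp add: map_nth)
qed

lemma subseq_imp_positions:
  assumes "subseq s xs"
  shows "\<exists>is. sorted_wrt (<) is \<and> (\<forall>i\<in>set is. i < length xs) \<and> s = map ((!) xs) is"
  using assms
proof (induction rule: list_emb.induct)
  case (list_emb_Nil ys)
  show ?case by (rule exI[of _ "[]"]) simp
next
  case (list_emb_Cons s xs x)
  then obtain "is" where "sorted_wrt (<) is" "\<forall>i\<in>set is. i < length xs" "s = map ((!) xs) is"
    by blast
  then show ?case
    by (intro exI[of _ "map Suc is"]) (simp add: sorted_wrt_map)
next
  case (list_emb_Cons2 x y s xs)
  then obtain "is" where "sorted_wrt (<) is" "\<forall>i\<in>set is. i < length xs" "s = map ((!) xs) is"
    by blast
  then show ?case
    using \<open>x = y\<close> by (intro exI[of _ "0 # map Suc is"]) (simp add: sorted_wrt_map)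
qed

lemma avoids_iff_positions:
  "avoids \<pi> q \<longleftrightarrow> \<not> (\<exists>is. sorted_wrt (<) is \<and> (\<forall>i\<in>set is. i < length \<pi>) \<and>
     order_isomorphic (map ((!) \<pi>) is) q)"
  unfolding avoids_def using subseq_nths_positions subseq_imp_positions by metis

section \<open>The pattern 132 and the two patterns of length four\<close>

definition has_132_at :: "'a::linorder list \<Rightarrow> nat \<Rightarrow> nat \<Rightarrow> nat \<Rightarrow> bool" where
  "has_132_at xs a b c \<longleftrightarrow> a < b \<and> b < c \<and> c < length xs \<and> xs ! a < xs ! c \<and> xs ! c < xs ! b"

lemma order_isomorphic_1324_iff:
  "order_isomorphic [w, x, y, z] [1,3,2,4] \<longleftrightarrow> w < y \<and> y < x \<and> x < z"
  by (simp add: order_isomorphic_def All_less_Suc numeral_eq_Suc) auto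

lemma order_isomorphic_1243_iff:
  "order_isomorphic [w, x, y, z] [1,2,4,3] \<longleftrightarrow> w < x \<and> x < z \<and> z < y"
  by (simp add: order_isomorphic_def All_less_Suc numeral_eq_Suc) auto

lemma not_avoids_1324:
  assumes "a < b" "b < c" "c < d" "d < length \<pi>"
    and "\<pi> ! a < \<pi> ! c" "\<pi> ! c < \<pi> ! b" "\<pi> ! b < \<pi> ! d"
  shows "\<not> avoids \<pi> [1,3,2,4]"
  unfolding avoids_iff_positions not_not
  by (rule exI[of _ "[a,b,c,d]"]) (use assms in \<open>simp add: order_isomorphic_1324_iff del: One_nat_def\<close>)

lemma not_avoids_1243:
  assumes "a < b" "b < c" "c < d" "d < length \<pi>"
    and "\<pi> ! a < \<pi> ! b" "\<pi> ! b < \<pi> ! d" "\<pi> ! d < \<pi> ! c"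
  shows "\<not> avoids \<pi> [1,2,4,3]"
  unfolding avoids_iff_positions not_not
  by (rule exI[of _ "[a,b,c,d]"]) (use assms in \<open>simp add: order_isomorphic_1243_iff del: One_nat_def\<close>)

text \<open>Both patterns contain 132: as 1, 3, 2 in 1324 and as 1, 4, 3 in 1243.\<close>

lemma has_132_if_not_avoids:
  assumes "\<not> avoids \<pi> [1,3,2,4] \<or> \<not> avoids \<pi> [1,2,4,3]"
  shows "\<exists>a b c. has_132_at \<pi> a b c"
proof -
  from assms obtain "is" q where "is": "sorted_wrt (<) is" "\<forall>i\<in>set is. i < length \<pi>"
    and iso: "order_isomorphic (map ((!) \<pi>) is) q" and q: "q = [1,3,2,4] \<or> q = [1,2,4,3]"
    unfolding avoids_iff_positions by blast
  have "length is = 4"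
    using iso q by (auto simp: order_isomorphic_def)
  then obtain a b c d where abcd: "is = [a,b,c,d]"
    by (auto simp: numeral_eq_Suc length_Suc_conv)
  from q show ?thesis
  proof
    assume q: "q = [1,3,2,4]"
    have "has_132_at \<pi> a b c"
      using "is" iso unfolding q abcd list.map order_isomorphic_1324_iff
      by (simp add: has_132_at_def)
    then show ?thesis by blast
  next
    assume q: "q = [1,2,4,3]"
    have "has_132_at \<pi> a c d"
      using "is" iso unfolding q abcd list.map order_isomorphic_1243_iff
      by (auto simp add: has_132_at_def)
    then show ?thesis by blast
  qed
qed

lemma finite_inversions: "finite (inversions \<pi>)"
  by (rule finite_subset[of _ "{..<length \<pi>} \<times> {..<length \<pi>}"]) (auto simp: inversions_def)

text \<open>Each position outside \<open>{a, b}\<close> is charged to an inversion that it forms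
  with \<open>a\<close>, \<open>b\<close> or \<open>c\<close>; the charging is injective, so
  \<open>length \<pi> - 2\<close> bounds the number of inversions from below.\<close>

lemma length_le_inversions_if_has_132:
  assumes "distinct \<pi>" "avoids \<pi> [1,3,2,4]" "avoids \<pi> [1,2,4,3]" and "has_132_at \<pi> a b c"
  shows "length \<pi> \<le> card (inversions \<pi>) + 2"
proof -
  from assms(4) have abc: "a < b" "b < c" "c < length \<pi>" "\<pi> ! a < \<pi> ! c" "\<pi> ! c < \<pi> ! b"
    by (auto simp: has_132_at_def)
  have neq: "\<pi> ! i \<noteq> \<pi> ! j" if "i < length \<pi>" "j < length \<pi>" "i \<noteq> j" for i j
    using that assms(1) by (simp add: nth_eq_iff_index_eq)
  \<comment> \<open>The partner of \<open>x\<close> is \<open>b\<close> if \<open>x\<close> lies at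
    or after \<open>c\<close>. Before \<open>c\<close>, the partner is \<open>c\<close> for values
    above \<open>\<pi> ! c\<close>; for smaller values it is \<open>b\<close> to the right of
    \<open>b\<close> and \<open>a\<close> to the left of \<open>b\<close>.\<close>
  define f where "f x =
    (if x \<ge> c then (b, x)
     else if \<pi> ! x > \<pi> ! c then (x, c)
     else if b < x then (b, x)
     else (min a x, max a x))" for x
  let ?X = "{..<length \<pi>} - {a, b}"
  \<comment> \<open>A left inverse of \<open>f\<close>: the partner is recognised by testing for
    \<open>b\<close>, then \<open>c\<close>, then \<open>a\<close>. The order matters for the pair
    \<open>(b, c)\<close>, which is charged by \<open>c\<close>.\<close>
  define g where "g p = (case p of (i, j) \<Rightarrow>
    if i = b then j else if j = c then i else if i = a then j else i)" for p
  have "g (f x) = x" if "x \<in> ?X" for x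
    using abc that by (simp add: f_def g_def min_def max_def)
  then have "inj_on f ?X"
    by (rule inj_on_inverseI)
  moreover have "f x \<in> inversions \<pi>" if x: "x \<in> ?X" for x
  proof -
    \<comment> \<open>Otherwise \<open>a, b, c, x\<close> would be an occurrence of 1324.\<close>
    have after: "\<pi> ! x < \<pi> ! b" if "x > c"
      using not_avoids_1324[of a b c x \<pi>] assms(2) abc x that neq[of x b] by fastforce
    \<comment> \<open>Otherwise \<open>a, x, b, c\<close> would be an occurrence of 1243; in
      \<open>left2\<close> the same holds for \<open>x, a, b, c\<close>.\<close>
    have left1: "\<pi> ! x < \<pi> ! a" if "a < x" "x < b" "\<pi> ! x < \<pi> ! c"
      using not_avoids_1243[of a x b c \<pi>] assms(3) abc x that neq[of x a] by fastforce
    have left2: "\<pi> ! a < \<pi> ! x" if "x < a" "\<pi> ! x < \<pi> ! c"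
      using not_avoids_1243[of x a b c \<pi>] assms(3) abc x that neq[of x a] by fastforce
    consider "x > c" | "x = c" | "x < c" "\<pi> ! x > \<pi> ! c" | "x < c" "\<pi> ! x < \<pi> ! c" "b < x"
      | "\<pi> ! x < \<pi> ! c" "a < x" "x < b" | "\<pi> ! x < \<pi> ! c" "x < a"
      using x abc neq[of x c] by fastforce
    then show ?thesis
      by cases (use x abc after left1 left2 in \<open>auto simp: f_def inversions_def min_def max_def\<close>)
  qed
  ultimately have "card ?X \<le> card (inversions \<pi>)"
    by (intro card_inj_on_le[of f] image_subsetI) (use finite_inversions in blast)+
  moreover have "card ?X = length \<pi> - 2"
    using abc by (simp add: card_Diff_subset)
  ultimately show ?thesis by linarith
qed

section \<open>Lehmer codes and inversions\<close>

text \<open>Each entry is compared only with later ones, so the tail of a code is the code of the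
  tail. Entries may come from any linear order, which lets inductions remove elements from the
  underlying set without relabelling.\<close>

fun lehmer :: "'a::linorder list \<Rightarrow> nat list" where
  "lehmer [] = []"
| "lehmer (x # xs) = length (filter (\<lambda>y. y < x) xs) # lehmer xs"

lemma length_lehmer [simp]: "length (lehmer xs) = length xs"
  by (induction xs) auto

lemma nth_lehmer:
  "i < length xs \<Longrightarrow> lehmer xs ! i = card {j. i < j \<and> j < length xs \<and> xs ! j < xs ! i}"
proof (induction xs arbitrary: i)
  case (Cons x xs)
  show ?case
  proof (cases i)
    case 0
    have "{j. 0 < j \<and> j < Suc (length xs) \<and> (x # xs) ! j < x} = Suc ` {j. j < length xs \<and> xs ! j < x}"
      by (auto simp: image_iff gr0_conv_Suc)
    then show ?thesis
      using 0 by (simp add: length_filter_conv_card card_image)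
  next
    case (Suc m)
    have "{j. Suc m < j \<and> j < Suc (length xs) \<and> (x # xs) ! j < xs ! m} =
        Suc ` {j. m < j \<and> j < length xs \<and> xs ! j < xs ! m}"
      by (auto simp: image_iff Suc_less_eq2)
    then show ?thesis
      using Suc Cons by (simp add: card_image)
  qed
qed simp

lemma nth_lehmer_less:
  assumes "i < length xs"
  shows "lehmer xs ! i + i < length xs"
proof -
  have "lehmer xs ! i \<le> card {i<..<length xs}"
    unfolding nth_lehmer[OF assms] by (rule card_mono) auto
  then show ?thesis using assms by simp
qed

text \<open>The code entry at \<open>i\<close> counts the inversions whose left position is
  \<open>i\<close>.\<close>

lemma sum_list_lehmer: "sum_list (lehmer \<pi>) = card (inversions \<pi>)"
proof -
  have "inversions \<pi> = (SIGMA i:{..<length \<pi>}. {j. i < j \<and> j < length \<pi> \<and> \<pi> ! j < \<pi> ! i})"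
    by (auto simp: inversions_def)
  then have "card (inversions \<pi>) = (\<Sum>i<length \<pi>. lehmer \<pi> ! i)"
    by (simp add: nth_lehmer)
  then show ?thesis
    by (simp add: sum_list_sum_nth atLeast0LessThan)
qed

text \<open>An occurrence of 132 can be moved until its first two positions are adjacent, and there
  the code ascends. Without 132, every later entry that is smaller than \<open>xs ! j\<close> is
  also smaller than any \<open>xs ! i\<close> with \<open>i < j\<close>.\<close>

lemma lehmer_decreasing_iff:
  assumes "distinct xs"
  shows "sorted_wrt (\<ge>) (lehmer xs) \<longleftrightarrow> \<not> (\<exists>a b c. has_132_at xs a b c)"
proof
  assume decr: "sorted_wrt (\<ge>) (lehmer xs)"
  have "\<not> has_132_at xs a b c" for a b c
  proof (induction "b - a" arbitrary: a b rule: less_induct)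
    case less
    show ?case
    proof
      assume H: "has_132_at xs a b c"
      show False
      proof (cases "b = Suc a")
        case True
        let ?S = "\<lambda>i. {j. i < j \<and> j < length xs \<and> xs ! j < xs ! i}"
        \<comment> \<open>Between \<open>a\<close> and \<open>b\<close> there is no position, and
          \<open>xs ! a < xs ! b\<close>; so all that is counted at \<open>a\<close> is counted at
          \<open>b\<close>, where \<open>c\<close> is counted in addition.\<close>
        have "?S a \<subset> ?S b"
        proof
          show "?S a \<subseteq> ?S b"
          proof
            fix j assume j: "j \<in> ?S a"
            then have "j \<noteq> b" using H by (auto simp: has_132_at_def)
            then show "j \<in> ?S b" using j H True by (auto simp: has_132_at_def)
          qed
          have "c \<in> ?S b - ?S a" using H by (auto simp: has_132_at_def)
          then show "?S a \<noteq> ?S b" by blast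
        qed
        then have "card (?S a) < card (?S b)"
          by (intro psubset_card_mono) auto
        then have "lehmer xs ! a < lehmer xs ! b"
          using H by (simp add: nth_lehmer has_132_at_def)
        moreover have "lehmer xs ! a \<ge> lehmer xs ! b"
          using decr H by (auto simp: sorted_wrt_iff_nth_less has_132_at_def)
        ultimately show False by simp
      next
        case False
        then have "Suc a < b" using H by (simp add: has_132_at_def)
        moreover have "xs ! Suc a \<noteq> xs ! c"
          using assms H \<open>Suc a < b\<close> by (simp add: nth_eq_iff_index_eq has_132_at_def)
        \<comment> \<open>If the value at \<open>Suc a\<close> is below \<open>xs ! c\<close>, it
          can replace the 1 of the pattern, otherwise the 3. Both choices shrink the gap.\<close>
        ultimately have "has_132_at xs (Suc a) b c \<or> has_132_at xs a (Suc a) c"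
          using H by (auto simp: has_132_at_def)
        then show False
          using less[of b "Suc a"] less[of "Suc a" a] \<open>Suc a < b\<close> by auto
      qed
    qed
  qed
  then show "\<not> (\<exists>a b c. has_132_at xs a b c)" by blast
next
  assume no: "\<not> (\<exists>a b c. has_132_at xs a b c)"
  show "sorted_wrt (\<ge>) (lehmer xs)"
    unfolding sorted_wrt_iff_nth_less
  proof (intro allI impI)
    fix i j assume ij: "i < j" "j < length (lehmer xs)"
    have "{l. j < l \<and> l < length xs \<and> xs ! l < xs ! j} \<subseteq> {l. i < l \<and> l < length xs \<and> xs ! l < xs ! i}"
    proof
      fix l assume l: "l \<in> {l. j < l \<and> l < length xs \<and> xs ! l < xs ! j}"
      \<comment> \<open>Otherwise \<open>i, j, l\<close> would be an occurrence of 132.\<close>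
      then have "\<not> xs ! i < xs ! l" using no ij by (auto simp: has_132_at_def)
      moreover have "xs ! i \<noteq> xs ! l" using assms l ij by (simp add: nth_eq_iff_index_eq)
      ultimately show "l \<in> {l. i < l \<and> l < length xs \<and> xs ! l < xs ! i}"
        using l ij by auto
    qed
    then have "card {l. j < l \<and> l < length xs \<and> xs ! l < xs ! j}
        \<le> card {l. i < l \<and> l < length xs \<and> xs ! l < xs ! i}"
      by (intro card_mono) auto
    then show "lehmer xs ! i \<ge> lehmer xs ! j"
      using ij by (simp add: nth_lehmer)
  qed
qed

section \<open>Reconstructing a permutation from its code\<close>

text \<open>The rank is strictly increasing, hence injective, and stays below \<open>card A\<close>
  since \<open>x\<close> does not count itself; equal cardinalities give surjectivity.\<close>

lemma bij_betw_rank: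
  fixes A :: "'a::linorder set"
  assumes "finite A"
  shows "bij_betw (\<lambda>x. card {y\<in>A. y < x}) A {..<card A}"
proof -
  let ?r = "\<lambda>x. card {y\<in>A. y < x}"
  have mono: "?r x < ?r y" if "x \<in> A" "x < y" for x y
    using assms that by (intro psubset_card_mono) auto
  have inj: "inj_on ?r A"
    using mono by (intro linorder_inj_onI') (metis (mono_tags) nat_neq_iff)
  moreover have "?r x < card A" if "x \<in> A" for x
    using assms that by (intro psubset_card_mono) auto
  then have "?r ` A \<subseteq> {..<card A}" by auto
  then have "?r ` A = {..<card A}"
    by (rule card_subset_eq[rotated]) (simp_all add: card_image inj)
  ultimately show ?thesis by (simp add: bij_betw_def)
qed

lemma hd_lehmer_eq_rank:
  fixes x :: "'a::linorder"
  assumes "distinct (x # xs)"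
  shows "length (filter (\<lambda>y. y < x) xs) = card {y \<in> set (x # xs). y < x}"
proof -
  have "{y \<in> set (x # xs). y < x} = set (filter (\<lambda>y. y < x) xs)" by auto
  then show ?thesis using assms by (simp only: distinct_card distinct_filter distinct.simps)
qed

text \<open>The first code entry is the rank of the first element in the common set, so it
  determines that element; removing it leaves equal sets and equal codes.\<close>

lemma lehmer_inject:
  assumes "distinct xs" "distinct ys" "set xs = set ys" "lehmer xs = lehmer ys"
  shows "xs = ys"
  using assms
proof (induction xs arbitrary: ys)
  case (Cons x xs)
  then obtain y ys' where ys: "ys = y # ys'" by (cases ys) auto
  have "inj_on (\<lambda>u. card {v \<in> set (x # xs). v < u}) (set (x # xs))"
    using bij_betw_rank by (rule bij_betw_imp_inj_on) simp
  moreover have "card {v \<in> set (x # xs). v < x} = card {v \<in> set (x # xs). v < y}"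
    using Cons.prems hd_lehmer_eq_rank[of x xs] hd_lehmer_eq_rank[of y ys'] ys by simp
  moreover have "y \<in> set (x # xs)" using Cons.prems ys by simp
  ultimately have "x = y" by (meson inj_onD list.set_intros(1))
  moreover from this have "set xs = set ys'"
    using Cons.prems ys by (auto simp: insert_eq_iff)
  ultimately show ?case using Cons ys by auto
qed simp

text \<open>The list is built greedily: it starts with the element of rank \<open>c\<close> in
  \<open>A\<close> and continues with the remaining elements.\<close>

lemma lehmer_surj:
  assumes "finite A" "length cs = card A" "\<forall>i<card A. cs ! i + i < card A"
  shows "\<exists>xs. distinct xs \<and> set xs = A \<and> lehmer xs = cs"
  using assms
proof (induction cs arbitrary: A)
  case (Cons c cs)
  have "c < card A" using Cons.prems(2) Cons.prems(3)[rule_format, of 0] by simp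
  then have "c \<in> (\<lambda>x. card {y\<in>A. y < x}) ` A"
    by (simp add: bij_betw_imp_surj_on[OF bij_betw_rank[OF Cons.prems(1)]])
  then obtain x where x: "x \<in> A" "card {y\<in>A. y < x} = c"
    by blast
  \<comment> \<open>The bound at index \<open>Suc i\<close> has one more on the left, which matches
    the loss of one element of \<open>A\<close>.\<close>
  have "cs ! i + i < card (A - {x})" if "i < card (A - {x})" for i
    using Cons.prems(3)[rule_format, of "Suc i"] Cons.prems(1) x that by (simp add: less_diff_conv)
  moreover have "length cs = card (A - {x})"
    using Cons.prems(1,2) x by simp
  ultimately obtain xs where xs: "distinct xs" "set xs = A - {x}" "lehmer xs = cs"
    using Cons.IH[of "A - {x}"] Cons.prems(1) by blast
  have "set (x # xs) = A" "distinct (x # xs)" using xs x by auto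
  moreover from this have "lehmer (x # xs) = c # cs"
    using hd_lehmer_eq_rank[of x xs] xs x by simp
  ultimately show ?case by blast
qed simp

lemma bij_betw_lehmer:
  assumes "finite A"
  shows "bij_betw lehmer (permutations_of_set A)
    {cs. length cs = card A \<and> (\<forall>i<card A. cs ! i + i < card A)}"
  unfolding bij_betw_def
proof (intro conjI)
  show "inj_on lehmer (permutations_of_set A)"
    by (rule inj_onI, rule lehmer_inject) (auto simp: permutations_of_set_def)
  show "lehmer ` permutations_of_set A = {cs. length cs = card A \<and> (\<forall>i<card A. cs ! i + i < card A)}"
  proof (intro equalityI subsetI)
    fix cs assume "cs \<in> lehmer ` permutations_of_set A"
    then obtain xs where "cs = lehmer xs" "xs \<in> permutations_of_set A" by blast
    moreover from this have "length xs = card A"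
      by (simp add: length_finite_permutations_of_set)
    ultimately show "cs \<in> {cs. length cs = card A \<and> (\<forall>i<card A. cs ! i + i < card A)}"
      using nth_lehmer_less[of _ xs] by simp
  next
    fix cs assume "cs \<in> {cs. length cs = card A \<and> (\<forall>i<card A. cs ! i + i < card A)}"
    then show "cs \<in> lehmer ` permutations_of_set A"
      using lehmer_surj[OF assms, of cs] by (auto simp: permutations_of_set_def)
  qed
qed

section \<open>Weakly decreasing codes and integer partitions\<close>

lemma length_le_sum_list:
  fixes xs :: "nat list"
  assumes "\<forall>x\<in>set xs. 0 < x"
  shows "length xs \<le> sum_list xs"
  using assms by (induction xs) auto

text \<open>The \<open>i\<close> entries before a positive entry are positive too, so they add at
  least \<open>i\<close> to the sum. For sum \<open>k < n\<close> this yields the bound required of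
  a code.\<close>

lemma decreasing_nth_bound:
  fixes cs :: "nat list"
  assumes "sorted_wrt (\<ge>) cs" "i < length cs" "0 < cs ! i"
  shows "cs ! i + i \<le> sum_list cs"
proof -
  have "x > 0" if "x \<in> set (take i cs)" for x
    using that assms by (fastforce simp: in_set_conv_nth sorted_wrt_iff_nth_less)
  then have "i \<le> sum_list (take i cs)"
    using length_le_sum_list[of "take i cs"] assms(2) by simp
  moreover have "sum_list cs = sum_list (take i cs) + (cs ! i + sum_list (drop (Suc i) cs))"
    using assms(2) by (metis id_take_nth_drop sum_list.Cons sum_list.append)
  ultimately show ?thesis by linarith
qed

lemma size_le_sum_mset:
  fixes P :: "nat multiset"
  assumes "\<forall>x\<in>#P. 0 < x"
  shows "size P \<le> \<Sum>\<^sub># P"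
  using assms by (induction P) auto

text \<open>Dropping the zeros loses nothing: their number is recovered from the length
  \<open>n\<close>, and the order from monotonicity. As \<open>k < n\<close>, each partition of
  \<open>k\<close> has few enough parts to be padded to length \<open>n\<close>.\<close>

lemma bij_betw_decreasing_partitions:
  assumes "k < n"
  shows "bij_betw (\<lambda>cs. filter_mset (\<lambda>x. 0 < x) (mset cs))
    {cs. length cs = n \<and> (\<forall>i<n. cs ! i + i < n) \<and> sorted_wrt (\<ge>) cs \<and> sum_list cs = k}
    (integer_partitions k)" (is "bij_betw ?f ?C _")
proof -
  have pad: "mset cs = ?f cs + replicate_mset (length cs - size (?f cs)) 0" for cs :: "nat list"
  proof -
    have split: "mset cs = ?f cs + filter_mset (\<lambda>x. \<not> 0 < x) (mset cs)"
      by (rule multiset_partition)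
    then have "length cs = size (?f cs) + size (filter_mset (\<lambda>x. \<not> 0 < x) (mset cs))"
      by (metis size_mset size_union)
    moreover have "filter_mset (\<lambda>x. \<not> 0 < x) (mset cs) =
        replicate_mset (size (filter_mset (\<lambda>x. \<not> 0 < x) (mset cs))) 0"
      by (simp add: filter_eq_replicate_mset)
    ultimately show ?thesis using split by simp
  qed
  show ?thesis
    unfolding bij_betw_def
  proof (intro conjI)
    show "inj_on ?f ?C"
    proof (rule inj_onI)
      fix cs ds assume cd: "cs \<in> ?C" "ds \<in> ?C" "?f cs = ?f ds"
      then have "mset cs = mset ds"
        using pad[of cs] pad[of ds] by simp
      moreover have "sorted (rev cs)" "sorted (rev ds)"
        using cd by (simp_all add: sorted_wrt_rev)
      ultimately have "rev cs = rev ds"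
        by (metis mset_rev properties_for_sort)
      then show "cs = ds" by simp
    qed
    show "?f ` ?C = integer_partitions k"
    proof (intro equalityI subsetI)
      fix P assume "P \<in> ?f ` ?C"
      then obtain cs where cs: "P = ?f cs" "sum_list cs = k" by blast
      have "\<Sum>\<^sub># P = \<Sum>\<^sub># (mset cs)"
        using pad[of cs] cs(1) by (metis add.right_neutral sum_mset.union sum_mset_replicate_mset mult_zero_right)
      then show "P \<in> integer_partitions k"
        using cs by (simp add: integer_partitions_def sum_mset_sum_list)
    next
      fix P assume "P \<in> integer_partitions k"
      then have P: "\<forall>x\<in>#P. 0 < x" "\<Sum>\<^sub># P = k" by (auto simp: integer_partitions_def)
      define M where "M = P + replicate_mset (n - size P) 0"
      define cs where "cs = rev (sorted_list_of_multiset M)"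
      have "size P \<le> n" using size_le_sum_mset[OF P(1)] P(2) assms by simp
      have mset: "mset cs = M" by (simp add: cs_def)
      have len: "length cs = n"
        using \<open>size P \<le> n\<close> mset by (simp add: M_def flip: size_mset)
      have decr: "sorted_wrt (\<ge>) cs"
        by (simp add: cs_def sorted_wrt_rev)
      have sum: "sum_list cs = k"
        using P(2) by (simp add: mset M_def flip: sum_mset_sum_list)
      \<comment> \<open>A zero entry satisfies the bound because \<open>i < n\<close>, a positive
        one because \<open>cs ! i + i\<close> is at most \<open>k\<close>.\<close>
      have "cs ! i + i < n" if "i < n" for i
        using decreasing_nth_bound[OF decr, of i] that len sum assms by (cases "cs ! i = 0") auto
      then have "cs \<in> ?C" using len decr sum by blast
      moreover have "filter_mset (\<lambda>x. 0 < x) P = P"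
        using P(1) by (simp add: filter_mset_eq_conv)
      then have "?f cs = P"
        by (simp add: mset M_def)
      ultimately show "P \<in> ?f ` ?C" by blast
    qed
  qed
qed

theorem proposition5p5:
  fixes n k :: nat
  assumes "n \<ge> k + 3"
  shows "av n k {[1,3,2,4], [1,2,4,3]} = num_partitions k"
proof -
  let ?L = "{cs. length cs = n \<and> (\<forall>i<n. cs ! i + i < n)}"
  let ?Q = "\<lambda>cs. sorted_wrt (\<ge>) cs \<and> sum_list cs = k"
  \<comment> \<open>An occurrence of 132 together with both avoidances would force
    \<open>n \<le> k + 2\<close>, against \<open>n \<ge> k + 3\<close>; conversely, avoiding 132
    implies avoiding both patterns.\<close>
  have iff: "card (inversions \<pi>) = k \<and> (\<forall>q\<in>{[1,3,2,4], [1,2,4,3]}. avoids \<pi> q) \<longleftrightarrow> ?Q (lehmer \<pi>)"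
    if "\<pi> \<in> permutations_of_set {1..n}" for \<pi>
  proof -
    have \<pi>: "distinct \<pi>" "length \<pi> = n"
      using that length_finite_permutations_of_set[OF that] by (auto simp: permutations_of_set_def)
    show ?thesis
      unfolding lehmer_decreasing_iff[OF \<pi>(1)] sum_list_lehmer
      using length_le_inversions_if_has_132[OF \<pi>(1)] has_132_if_not_avoids[of \<pi>] \<pi>(2) assms
      by fastforce
  qed
  have bij: "bij_betw lehmer (permutations_of_set {1..n}) ?L"
    using bij_betw_lehmer[of "{1..n}"] by simp
  have "bij_betw lehmer
      {\<pi> \<in> permutations_of_set {1..n}. card (inversions \<pi>) = k \<and>
        (\<forall>q\<in>{[1,3,2,4], [1,2,4,3]}. avoids \<pi> q)}
      {cs \<in> ?L. ?Q cs}"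
    using bij by (rule bij_betw_Collect) (use iff in blast)
  then have "av n k {[1,3,2,4], [1,2,4,3]} = card {cs \<in> ?L. ?Q cs}"
    unfolding av_def by (rule bij_betw_same_card)
  also have "\<dots> = num_partitions k"
    using bij_betw_same_card[OF bij_betw_decreasing_partitions[of k n]] assms
    by (simp add: num_partitions_def)
  finally show ?thesis .
qed

end
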